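(* Let $X$ be a metric space and $A\subset X$ a subset that is $M$-doubling for some $M\ge 2$. Suppose that $Y$ is a Banach space. Then every $1$-Lipschitz map $f\colon A\to Y$ admits a Lipschitz extension $F\colon X\to Y$ with Lipschitz constant at most $$10^5\cdot \log(M).$$
   Context: $\log$ is the natural logarithm. A metric space is called $M$-doubling if every (closed) ball in it can be covered by at most $M$ balls of half the radius; $A$ is considered as a metric space with the induced metric. *)

theory Defs
  imports "HOL-Analysis.Analysis"
begin

text \<open>
  The set \<open>A\<close> is regarded as a metric space with the induced metric: the centres of all balls,
  including the covering ones, lie in \<open>A\<close>, and only points of \<open>A\<close> have to be covered.
  The bound \<open>M\<close> may be any real number.
\<close>

definition doubling :: "real \<Rightarrow> 'a::metric_space set \<Rightarrow> bool" where
  "doubling M A \<longleftrightarrow>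
     (\<forall>x\<in>A. \<forall>r>0. \<exists>C. C \<subseteq> A \<and> finite C \<and> real (card C) \<le> M \<and>
        cball x r \<inter> A \<subseteq> (\<Union>c\<in>C. cball c (r / 2)))"

end

theory Submission
  imports Defs
begin

text \<open>
  At each scale \<open>s\<close>, average \<open>f\<close> over an \<open>s\<close>-net of \<open>A\<close> with the truncated exponential weights
  \<open>max 0 (exp (- p * dist x a / s) - exp (- 5 * p))\<close>, where \<open>p = 6 * ln M\<close>. Only points of the net
  within \<open>5 * s\<close> of \<open>x\<close> contribute, and there are at most \<open>M ^ 5\<close> of them, while some point has
  weight at least \<open>exp (- 4 * p) - exp (- 5 * p) \<ge> M ^ 5 * exp (- 5 * p)\<close>. Hence the truncation error
  is absorbed by the total weight, the normalised weights inherit the logarithmic derivative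
  \<open>p / s\<close> of the exponential, and the averages are Lipschitz with constant of order \<open>p\<close> at distance
  less than \<open>3 * s\<close> from \<open>A\<close>. The extension interpolates linearly in \<open>infdist x A\<close> between the
  averages at consecutive dyadic scales; it is then defined off the closure of \<open>A\<close> and on \<open>A\<close>,
  a dense set, and completeness of the target does the rest.
\<close>

section \<open>Separated nets and counting in doubling sets\<close>

lemma exists_maximal_separated:
  fixes A :: "'a::metric_space set"
  assumes "s > 0"
  obtains N where "N \<subseteq> A" "\<And>a b. a \<in> N \<Longrightarrow> b \<in> N \<Longrightarrow> a \<noteq> b \<Longrightarrow> dist a b > s"
    "\<And>a. a \<in> A \<Longrightarrow> \<exists>b\<in>N. dist a b \<le> s"
proof -
  define P where "P = {N. N \<subseteq> A \<and> (\<forall>a\<in>N. \<forall>b\<in>N. a \<noteq> b \<longrightarrow> dist a b > s)}"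
  have "\<exists>N\<in>P. \<forall>X\<in>P. N \<subseteq> X \<longrightarrow> X = N"
  proof (rule subset_Zorn')
    fix C assume C: "subset.chain P C"
    have sub: "N \<in> P" if "N \<in> C" for N
      using C that by (auto simp: subset.chain_def)
    have "dist a b > s" if ab: "a \<in> \<Union>C" "b \<in> \<Union>C" "a \<noteq> b" for a b
    proof -
      obtain U V where UV: "U \<in> C" "V \<in> C" "a \<in> U" "b \<in> V" using ab by auto
      have "U \<subseteq> V \<or> V \<subseteq> U" using C UV by (auto simp: subset_chain_def)
      then obtain W where "W \<in> C" "a \<in> W" "b \<in> W" using UV by blast
      then show ?thesis using sub[of W] ab(3) by (auto simp: P_def)
    qed
    then show "\<Union>C \<in> P" using sub by (force simp: P_def)
  qed
  then obtain N where N: "N \<in> P" "\<And>X. X \<in> P \<Longrightarrow> N \<subseteq> X \<Longrightarrow> X = N" by blast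
  have "\<exists>b\<in>N. dist a b \<le> s" if a: "a \<in> A" for a
  proof (rule ccontr)
    assume neg: "\<not> (\<exists>b\<in>N. dist a b \<le> s)"
    then have "insert a N \<in> P" using N(1) a by (auto simp: P_def dist_commute not_le)
    then have "a \<in> N" using N(2)[of "insert a N"] by blast
    then show False using neg assms by force
  qed
  then show thesis using that[of N] N(1) by (auto simp: P_def)
qed

lemma doubling_iterate:
  assumes dbl: "doubling M A" and M: "M \<ge> 0" and "x \<in> A" and r: "r > 0"
  shows "\<exists>C. C \<subseteq> A \<and> finite C \<and> real (card C) \<le> M ^ k \<and>
           cball x r \<inter> A \<subseteq> (\<Union>c\<in>C. cball c (r / 2 ^ k))"
proof (induction k)
  case 0
  show ?case by (rule exI[of _ "{x}"]) (use assms in auto)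
next
  case (Suc k)
  then obtain C where C: "C \<subseteq> A" "finite C" "real (card C) \<le> M ^ k"
    "cball x r \<inter> A \<subseteq> (\<Union>c\<in>C. cball c (r / 2 ^ k))" by blast
  have "r / 2 ^ k > 0" using r by simp
  then have "\<forall>c\<in>C. \<exists>D. D \<subseteq> A \<and> finite D \<and> real (card D) \<le> M \<and>
      cball c (r / 2 ^ k) \<inter> A \<subseteq> (\<Union>d\<in>D. cball d (r / 2 ^ k / 2))"
    using dbl C(1) unfolding doubling_def by blast
  then obtain D where D: "\<And>c. c \<in> C \<Longrightarrow> D c \<subseteq> A" "\<And>c. c \<in> C \<Longrightarrow> finite (D c)"
    "\<And>c. c \<in> C \<Longrightarrow> real (card (D c)) \<le> M"
    "\<And>c. c \<in> C \<Longrightarrow> cball c (r / 2 ^ k) \<inter> A \<subseteq> (\<Union>d\<in>D c. cball d (r / 2 ^ k / 2))"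
    by metis
  have "real (card (\<Union>c\<in>C. D c)) \<le> real (\<Sum>c\<in>C. card (D c))"
    using card_UN_le[OF C(2)] by (simp only: of_nat_le_iff)
  also have "\<dots> \<le> (\<Sum>c\<in>C. M)" unfolding of_nat_sum by (rule sum_mono) (rule D(3))
  also have "\<dots> \<le> M ^ k * M" using C(3) M by (simp add: mult_right_mono)
  finally have card: "real (card (\<Union>c\<in>C. D c)) \<le> M ^ Suc k" by (simp add: mult.commute)
  have "cball x r \<inter> A \<subseteq> (\<Union>d\<in>(\<Union>c\<in>C. D c). cball d (r / 2 ^ Suc k))"
  proof
    fix y assume y: "y \<in> cball x r \<inter> A"
    then obtain c where c: "c \<in> C" "y \<in> cball c (r / 2 ^ k)" using C(4) by blast
    then obtain d where "d \<in> D c" "y \<in> cball d (r / 2 ^ k / 2)" using D(4)[OF c(1)] y by blast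
    then show "y \<in> (\<Union>d\<in>(\<Union>c\<in>C. D c). cball d (r / 2 ^ Suc k))"
      using c(1) by (auto simp: field_simps)
  qed
  with card show ?case
    using C(2) D(1,2) by (intro exI[of _ "\<Union>c\<in>C. D c"]) auto
qed

text \<open>The centre \<open>x\<close> may lie outside \<open>A\<close>, so the ball is recentred
  at a point of \<open>N\<close> and its radius doubled. After \<open>k\<close> halvings the
  covering balls have radius at most \<open>s / 2\<close>, and such a ball holds at most one point
  of \<open>N\<close>.\<close>

lemma separated_card_le:
  fixes A :: "'a::metric_space set"
  assumes dbl: "doubling M A" and M: "M \<ge> 0" and "N \<subseteq> A"
    and sep: "\<And>a b. a \<in> N \<Longrightarrow> b \<in> N \<Longrightarrow> a \<noteq> b \<Longrightarrow> dist a b > s"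
    and r: "r > 0" and rs: "4 * r \<le> s * 2 ^ k"
  shows "finite (N \<inter> cball x r) \<and> real (card (N \<inter> cball x r)) \<le> M ^ k"
proof (cases "N \<inter> cball x r = {}")
  case True
  then show ?thesis using M by simp
next
  case False
  then obtain a0 where a0: "a0 \<in> N" "dist x a0 \<le> r" by auto
  then have "a0 \<in> A" using assms(3) by auto
  then obtain C where C: "finite C" "real (card C) \<le> M ^ k"
    "cball a0 (2 * r) \<inter> A \<subseteq> (\<Union>c\<in>C. cball c (2 * r / 2 ^ k))"
    using doubling_iterate[OF dbl M, of a0 "2 * r" k] r by auto
  have "\<exists>c\<in>C. dist c a \<le> s / 2" if a: "a \<in> N \<inter> cball x r" for a
  proof -
    have "dist a0 a \<le> 2 * r" using a a0 dist_triangle3[of a0 a x] by auto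
    then obtain c where "c \<in> C" "dist c a \<le> 2 * r / 2 ^ k"
      using C(3) a assms(3) by (auto simp: subset_iff)
    moreover have "2 * r / 2 ^ k \<le> s / 2" using rs by (simp add: field_simps)
    ultimately show ?thesis by force
  qed
  then obtain h where h: "\<And>a. a \<in> N \<inter> cball x r \<Longrightarrow> h a \<in> C \<and> dist (h a) a \<le> s / 2" by metis
  have inj: "inj_on h (N \<inter> cball x r)"
  proof (rule inj_onI, rule ccontr)
    fix a b assume ab: "a \<in> N \<inter> cball x r" "b \<in> N \<inter> cball x r" "h a = h b" "a \<noteq> b"
    then have "dist a b \<le> s"
      using h[of a] h[of b] dist_triangle3[of a b "h a"] by auto
    then show False using sep[of a b] ab by auto
  qed
  have sub: "h ` (N \<inter> cball x r) \<subseteq> C" using h by blast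
  have "real (card (N \<inter> cball x r)) \<le> real (card C)"
    using card_inj_on_le[OF inj sub C(1)] by simp
  then show ?thesis using C inj_on_finite[OF inj sub] by linarith
qed

section \<open>Truncated exponential weights and weighted means\<close>

text \<open>For \<open>b \<le> a\<close> the tangent line of \<open>exp\<close> at \<open>a\<close>
  gives \<open>exp a - exp b \<le> (a - b) * exp a\<close>, and \<open>exp a\<close> exceeds its
  truncation by at most \<open>c\<close>. So truncation keeps the logarithmic derivative of
  \<open>exp\<close> up to the additive error \<open>c\<close>.\<close>

lemma truncated_exp_diff_le:
  fixes u v c :: real
  assumes "c \<ge> 0"
  shows "\<bar>max 0 (exp u - c) - max 0 (exp v - c)\<bar>
           \<le> \<bar>u - v\<bar> * (max 0 (exp u - c) + max 0 (exp v - c) + c)"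
proof -
  have *: "max 0 (exp a - c) - max 0 (exp b - c)
      \<le> (a - b) * (max 0 (exp a - c) + max 0 (exp b - c) + c)" if "b \<le> a" for a b :: real
  proof -
    have "exp b = exp a * exp (b - a)" by (simp flip: exp_add)
    moreover have "exp a * exp (b - a) \<ge> exp a * (1 + (b - a))"
      using exp_ge_add_one_self[of "b - a"] by (intro mult_left_mono) auto
    ultimately have "exp a - exp b \<le> (a - b) * exp a" by (simp add: algebra_simps)
    moreover have "max 0 (exp a - c) - max 0 (exp b - c) \<le> exp a - exp b"
      using that exp_le_cancel_iff[of b a] by (auto simp: max_def simp del: exp_le_cancel_iff)
    moreover have "(a - b) * exp a \<le> (a - b) * (max 0 (exp a - c) + max 0 (exp b - c) + c)"
      using that by (intro mult_left_mono) auto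
    ultimately show ?thesis by linarith
  qed
  have mono: "max 0 (exp a - c) \<le> max 0 (exp b - c)" if "a \<le> b" for a b :: real
    using that by (intro max.mono) auto
  show ?thesis
  proof (cases "v \<le> u")
    case True
    then show ?thesis using *[OF True] mono[OF True] by simp
  next
    case False
    then have "u \<le> v" by simp
    then show ?thesis using *[of u v] mono[of u v] by (simp add: ac_simps)
  qed
qed

definition weighted_mean :: "('a \<Rightarrow> real) \<Rightarrow> ('a \<Rightarrow> 'b::real_normed_vector) \<Rightarrow> 'a set \<Rightarrow> 'b" where
  "weighted_mean w f T = (\<Sum>a\<in>T. w a *\<^sub>R f a) /\<^sub>R (\<Sum>a\<in>T. w a)"

lemma weighted_mean_diff:
  assumes "(\<Sum>a\<in>T. w a) > 0"
  shows "(\<Sum>a\<in>T. w a) *\<^sub>R (weighted_mean w f T - z) = (\<Sum>a\<in>T. w a *\<^sub>R (f a - z))"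
  using assms by (simp add: weighted_mean_def scaleR_diff_right sum_subtractf scaleR_left.sum)

lemma norm_weighted_mean_diff_le:
  assumes w: "\<And>a. a \<in> T \<Longrightarrow> w a \<ge> 0" and pos: "(\<Sum>a\<in>T. w a) > 0"
    and B: "\<And>a. a \<in> T \<Longrightarrow> w a > 0 \<Longrightarrow> norm (f a - z) \<le> B"
  shows "norm (weighted_mean w f T - z) \<le> B"
proof -
  have "(\<Sum>a\<in>T. w a) * norm (weighted_mean w f T - z) = norm (\<Sum>a\<in>T. w a *\<^sub>R (f a - z))"
    unfolding weighted_mean_diff[OF pos, symmetric] using pos by simp
  also have "\<dots> \<le> (\<Sum>a\<in>T. w a * B)"
  proof (rule sum_norm_le)
    fix a assume a: "a \<in> T"
    show "norm (w a *\<^sub>R (f a - z)) \<le> w a * B"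
      using w[OF a] B[OF a] by (cases "w a = 0") (auto intro: mult_left_mono)
  qed
  also have "\<dots> = (\<Sum>a\<in>T. w a) * B" by (simp add: sum_distrib_right)
  finally show ?thesis using pos by simp
qed

text \<open>Measured from the mean for \<open>w'\<close>, the deviations of \<open>f\<close> have
  \<open>w'\<close>-weighted sum zero, so only the differences \<open>w a - w' a\<close> act on
  them. \<open>E\<close> is the change of the weights relative to the total of
  \<open>w\<close>.\<close>

lemma norm_weighted_mean_diff_weights_le:
  assumes pos: "(\<Sum>a\<in>T. w a) > 0" and pos': "(\<Sum>a\<in>T. w' a) > 0"
    and B: "\<And>a. a \<in> T \<Longrightarrow> norm (f a - weighted_mean w' f T) \<le> B"
    and E: "(\<Sum>a\<in>T. \<bar>w a - w' a\<bar>) \<le> E * (\<Sum>a\<in>T. w a)" and B0: "B \<ge> 0"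
  shows "norm (weighted_mean w f T - weighted_mean w' f T) \<le> E * B"
proof -
  let ?z = "weighted_mean w' f T"
  have "(\<Sum>a\<in>T. w' a *\<^sub>R (f a - ?z)) = 0"
    using weighted_mean_diff[OF pos', of f ?z] by simp
  then have "(\<Sum>a\<in>T. w a) *\<^sub>R (weighted_mean w f T - ?z) = (\<Sum>a\<in>T. (w a - w' a) *\<^sub>R (f a - ?z))"
    unfolding weighted_mean_diff[OF pos] scaleR_diff_left sum_subtractf by simp
  then have "(\<Sum>a\<in>T. w a) * norm (weighted_mean w f T - ?z) = norm (\<Sum>a\<in>T. (w a - w' a) *\<^sub>R (f a - ?z))"
    using pos by (metis abs_of_pos norm_scaleR)
  also have "\<dots> \<le> (\<Sum>a\<in>T. \<bar>w a - w' a\<bar> * B)"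
    by (rule sum_norm_le) (auto intro: mult_left_mono B)
  also have "\<dots> \<le> (E * (\<Sum>a\<in>T. w a)) * B"
    unfolding sum_distrib_right[symmetric] by (rule mult_right_mono[OF E B0])
  finally have "(\<Sum>a\<in>T. w a) * norm (weighted_mean w f T - ?z) \<le> (\<Sum>a\<in>T. w a) * (E * B)"
    by (simp add: ac_simps)
  then show ?thesis using pos by simp
qed

text \<open>Serves to write the averages at two different points over one common finite set.\<close>

lemma weighted_mean_mono_neutral:
  assumes "finite T" "T' \<subseteq> T" "\<And>a. a \<in> T - T' \<Longrightarrow> w a = 0"
  shows "weighted_mean w f T' = weighted_mean w f T"
  unfolding weighted_mean_def
  using assms by (auto intro!: arg_cong2[where f = "\<lambda>x y. x /\<^sub>R y"] sum.mono_neutral_left)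

section \<open>Lipschitz averages at a single scale\<close>

lemma infdist_lessE:
  assumes "A \<noteq> {}" "infdist x A < r"
  obtains a where "a \<in> A" "dist x a < r"
  using assms by (auto simp: infdist_notempty cINF_less_iff)

lemma extension_at_scale:
  fixes A :: "'a::metric_space set" and f :: "'a \<Rightarrow> 'b::real_normed_vector"
  assumes M: "M \<ge> 2" and dbl: "doubling M A" and lip: "1-lipschitz_on A f"
    and ne: "A \<noteq> {}" and s: "s > 0"
  shows "\<exists>G. (\<forall>x a. infdist x A < 3 * s \<longrightarrow> a \<in> A \<longrightarrow> norm (G x - f a) \<le> dist x a + 5 * s) \<and>
             (264 * ln M)-lipschitz_on {x. infdist x A < 3 * s} G"
proof -
  obtain N where N: "N \<subseteq> A" "\<And>a b. a \<in> N \<Longrightarrow> b \<in> N \<Longrightarrow> a \<noteq> b \<Longrightarrow> dist a b > s"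
    "\<And>a. a \<in> A \<Longrightarrow> \<exists>b\<in>N. dist a b \<le> s"
    using exists_maximal_separated[OF s] by metis
  define p where "p = 6 * ln M"
  define c where "c = exp (- 5 * p)"
  define w where "w = (\<lambda>(x::'a) a. max 0 (exp (- p * dist x a / s) - c))"
  define T where "T = (\<lambda>x. N \<inter> cball x (5 * s))"
  define G where "G = (\<lambda>x. weighted_mean (w x) f (T x))"
  have p: "p > 0" using M by (simp add: p_def)
  have c: "c > 0" by (simp add: c_def)
  \<comment> \<open>Radius \<open>5 * s\<close> takes five halvings, since
    \<open>4 * (5 * s) \<le> s * 2 ^ 5\<close>.\<close>
  have fin: "finite (T x)" and card: "real (card (T x)) \<le> M ^ 5" for x
    using separated_card_le[OF dbl _ N(1,2), of "5 * s" 5 x] M s by (auto simp: T_def)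
  have w0: "w x a \<ge> 0" for x a by (simp add: w_def)
  have wz: "w x a = 0" if "a \<in> N" "a \<notin> T x" for x a
  proof -
    have "dist x a \<ge> 5 * s" using that by (simp add: T_def)
    then have "p * (5 * s) \<le> p * dist x a" using p by simp
    then have "- p * dist x a / s \<le> - 5 * p" using s by (simp add: field_simps)
    then have "exp (- p * dist x a / s) \<le> c" unfolding c_def by (simp only: exp_le_cancel_iff)
    then show ?thesis by (simp add: w_def)
  qed
  have fd: "norm (f a - f b) \<le> dist a b" if "a \<in> A" "b \<in> A" for a b
    using lipschitz_onD[OF lip that] by (simp add: dist_norm)
  have TA: "T x \<subseteq> A" for x using N(1) by (auto simp: T_def)
  \<comment> \<open>This is the purpose of the factor 6 in \<open>p\<close>. The summand 1 pays for
    the \<open>c\<close> subtracted in the weight, so that \<open>c * M ^ 5\<close> is left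
    over.\<close>
  have expp: "exp p \<ge> M ^ 5 + 1"
  proof -
    have "exp p = exp (ln M) ^ 6" unfolding p_def by (simp flip: exp_of_nat_mult)
    also have "\<dots> = M ^ 5 * M" using M by (simp add: eval_nat_numeral)
    also have "\<dots> \<ge> M ^ 5 * 2" using M by (intro mult_left_mono) auto
    moreover have "M ^ 5 \<ge> 1" using M by (intro one_le_power) auto
    ultimately show ?thesis by linarith
  qed
  \<comment> \<open>Some net point lies within \<open>3 * s + s\<close> of \<open>x\<close>, one
    \<open>s\<close> inside the cutoff radius \<open>5 * s\<close>; this margin yields the factor
    \<open>exp p\<close> over \<open>c\<close>.\<close>
  have large: "c * M ^ 5 \<le> (\<Sum>a\<in>T x. w x a)" if x: "infdist x A < 3 * s" for x
  proof -
    obtain a where a: "a \<in> A" "dist x a < 3 * s" using infdist_lessE[OF ne x] .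
    obtain b where b: "b \<in> N" "dist a b \<le> s" using N(3)[OF a(1)] by blast
    have d: "dist x b \<le> 4 * s" using dist_triangle[of x b a] a b by linarith
    then have bT: "b \<in> T x" using b s by (simp add: T_def)
    have "p * dist x b \<le> p * (4 * s)" using d p by simp
    then have "- 4 * p \<le> - p * dist x b / s" using s by (simp add: field_simps)
    then have "exp (- 4 * p) \<le> exp (- p * dist x b / s)" by (simp only: exp_le_cancel_iff)
    moreover have "exp (- 4 * p) = c * exp p" by (simp add: c_def flip: exp_add)
    moreover have "c * exp p \<ge> c * (M ^ 5 + 1)" using expp c by (intro mult_left_mono) auto
    ultimately have "c * (M ^ 5 + 1) \<le> exp (- p * dist x b / s)" by linarith
    then have "c * M ^ 5 \<le> w x b" unfolding w_def by (simp only: distrib_left)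
    also have "\<dots> \<le> (\<Sum>a\<in>T x. w x a)" using fin bT w0 by (intro member_le_sum) auto
    finally show ?thesis .
  qed
  have cM: "c * M ^ 5 > 0" using c M by simp
  have near: "norm (G x - f a) \<le> dist x a + 5 * s" if x: "infdist x A < 3 * s" and a: "a \<in> A" for x a
    unfolding G_def
  proof (rule norm_weighted_mean_diff_le)
    show "0 < (\<Sum>a\<in>T x. w x a)" using large[OF x] cM by linarith
    fix b assume b: "b \<in> T x"
    then have "norm (f b - f a) \<le> dist b a" using fd a TA by blast
    also have "\<dots> \<le> dist x a + dist x b" using dist_triangle3[of b a x] by simp
    finally show "norm (f b - f a) \<le> dist x a + 5 * s" using b by (simp add: T_def)
  qed (rule w0)
  \<comment> \<open>Taking \<open>x\<close> to be the point with the larger total weight lets every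
    error be measured by that total alone; the other order follows by symmetry.\<close>
  have lipG: "norm (G x - G y) \<le> 44 * p * dist x y"
    if x: "infdist x A < 3 * s" and y: "infdist y A < 3 * s"
      and le: "(\<Sum>a\<in>T y. w y a) \<le> (\<Sum>a\<in>T x. w x a)" and D: "dist x y \<le> s" for x y
  proof -
    define U where "U = T x \<union> T y"
    have U: "finite U" "T x \<subseteq> U" "T y \<subseteq> U" using fin by (auto simp: U_def)
    have UN: "U \<subseteq> N" by (auto simp: U_def T_def)
    have Sx: "(\<Sum>a\<in>U. w x a) = (\<Sum>a\<in>T x. w x a)"
      using U UN wz by (intro sum.mono_neutral_right) auto
    have Sy: "(\<Sum>a\<in>U. w y a) = (\<Sum>a\<in>T y. w y a)"
      using U UN wz by (intro sum.mono_neutral_right) auto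
    have Gx: "G x = weighted_mean (w x) f U"
      unfolding G_def using U UN wz by (intro weighted_mean_mono_neutral) auto
    have Gy: "G y = weighted_mean (w y) f U"
      unfolding G_def using U UN wz by (intro weighted_mean_mono_neutral) auto
    let ?S = "\<Sum>a\<in>U. w x a"
    define e where "e = p * dist x y / s"
    have e0: "e \<ge> 0" using p s by (simp add: e_def)
    have "\<bar>w x a - w y a\<bar> \<le> e * (w x a + w y a + c)" for a
    proof -
      have "\<bar>(- p * dist x a / s) - (- p * dist y a / s)\<bar> = p * \<bar>dist x a - dist y a\<bar> / s"
        using p s by (simp add: abs_mult abs_minus_commute flip: diff_divide_distrib right_diff_distrib)
      also have "\<dots> \<le> e" unfolding e_def
        using p s abs_dist_diff_le[of x a y] by (intro divide_right_mono mult_left_mono) (auto simp: dist_commute)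
      finally have *: "\<bar>(- p * dist x a / s) - (- p * dist y a / s)\<bar> \<le> e" .
      have "\<bar>w x a - w y a\<bar> \<le> \<bar>(- p * dist x a / s) - (- p * dist y a / s)\<bar> * (w x a + w y a + c)"
        unfolding w_def using c by (intro truncated_exp_diff_le) auto
      also have "\<dots> \<le> e * (w x a + w y a + c)"
        using w0[of x a] w0[of y a] c by (intro mult_right_mono[OF *]) auto
      finally show ?thesis .
    qed
    then have "(\<Sum>a\<in>U. \<bar>w x a - w y a\<bar>) \<le> (\<Sum>a\<in>U. e * (w x a + w y a + c))"
      by (intro sum_mono)
    also have "\<dots> = e * (?S + (\<Sum>a\<in>U. w y a) + c * real (card U))"
      by (simp add: sum.distrib algebra_simps flip: sum_distrib_left)
    \<comment> \<open>Each of the two totals is at most \<open>?S\<close>. The truncation errors,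
      one \<open>c\<close> for each of at most \<open>2 * M ^ 5\<close> points, add at most
      \<open>2 * ?S\<close> by \<open>large\<close>.\<close>
    also have "\<dots> \<le> e * (4 * ?S)"
    proof (rule mult_left_mono[OF _ e0])
      have "real (card U) \<le> real (card (T x) + card (T y))"
        unfolding U_def by (simp only: of_nat_le_iff card_Un_le)
      then have "real (card U) \<le> 2 * M ^ 5" using card[of x] card[of y] by simp
      then have "c * real (card U) \<le> c * (2 * M ^ 5)" using c by (intro mult_left_mono) auto
      then show "?S + (\<Sum>a\<in>U. w y a) + c * real (card U) \<le> 4 * ?S"
        using large[OF x] le unfolding Sx Sy by simp
    qed
    finally have E: "(\<Sum>a\<in>U. \<bar>w x a - w y a\<bar>) \<le> (4 * e) * ?S" by simp
    have "norm (G x - G y) \<le> (4 * e) * (11 * s)"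
      unfolding Gx Gy
    proof (rule norm_weighted_mean_diff_weights_le[OF _ _ _ E])
      show "0 < ?S" using large[OF x] cM Sx by linarith
      show "0 < (\<Sum>a\<in>U. w y a)" using large[OF y] cM Sy by linarith
      show "0 \<le> 11 * s" using s by simp
      fix a assume a: "a \<in> U"
      \<comment> \<open>A point of \<open>U\<close> is within \<open>5 * s\<close> of
        \<open>x\<close> or of \<open>y\<close>, hence within \<open>6 * s\<close> of
        \<open>y\<close>; the estimate \<open>near\<close> adds the other
        \<open>5 * s\<close>.\<close>
      have "dist y a \<le> 6 * s"
        using a D s dist_triangle3[of y a x] by (auto simp: U_def T_def)
      moreover have "a \<in> A" using a UN N(1) by auto
      ultimately show "norm (f a - weighted_mean (w y) f U) \<le> 11 * s"
        using near[OF y, of a] by (simp add: Gy norm_minus_commute)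
    qed
    also have "\<dots> = 44 * p * dist x y" using s by (simp add: e_def)
    finally show ?thesis .
  qed
  have "(264 * ln M)-lipschitz_on {x. infdist x A < 3 * s} G"
  proof (rule lipschitz_onI)
    fix x y assume xy: "x \<in> {x. infdist x A < 3 * s}" "y \<in> {x. infdist x A < 3 * s}"
    show "dist (G x) (G y) \<le> 264 * ln M * dist x y"
    proof (cases "dist x y \<le> s")
      case True
      then show ?thesis
        using lipG[of x y] lipG[of y x] xy
        by (cases "(\<Sum>a\<in>T y. w y a) \<le> (\<Sum>a\<in>T x. w x a)")
          (auto simp: dist_norm norm_minus_commute dist_commute p_def)
    next
      case False
      obtain a where a: "a \<in> A" "dist x a < 3 * s" using infdist_lessE[OF ne] xy by auto
      \<comment> \<open>Pairs further apart than \<open>s\<close> are compared through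
        \<open>f a\<close>: the cost is at most \<open>16 * s + dist x y\<close>.\<close>
      have "norm (G x - G y) \<le> norm (G x - f a) + norm (G y - f a)"
        using norm_triangle_ineq4[of "G x - f a" "G y - f a"] by simp
      also have "\<dots> \<le> (dist x a + 5 * s) + (dist y a + 5 * s)"
        using near a xy by (intro add_mono) auto
      also have "\<dots> \<le> 17 * dist x y"
        using False a dist_triangle3[of y a x] by (simp add: dist_commute)
      also have "\<dots> \<le> 264 * ln M * dist x y"
      proof (rule mult_right_mono)
        have "ln M \<ge> ln 2" using M by simp
        then show "17 \<le> 264 * ln M" using ln2_ge_two_thirds by linarith
      qed simp
      finally show ?thesis by (simp add: dist_norm)
    qed
  qed (use M in simp)
  with near show ?thesis by blast
qed

section \<open>Gluing the dyadic scales\<close>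

text \<open>\<open>\<sigma> t\<close> is the largest power of two, with integer exponent, not
  exceeding \<open>t\<close>. The last part confines nearby points to the same or to adjacent dyadic
  shells.\<close>

lemma dyadic_scale:
  fixes t :: real
  defines "\<sigma> \<equiv> \<lambda>t. (2::real) powr of_int \<lfloor>log 2 t\<rfloor>"
  assumes "t > 0"
  shows "\<sigma> t > 0" "\<sigma> t \<le> t" "t < 2 * \<sigma> t"
    and "t / 2 < u \<Longrightarrow> u \<le> t \<Longrightarrow> \<sigma> u = \<sigma> t \<or> \<sigma> u = \<sigma> t / 2"
proof -
  have t: "t = 2 powr log 2 t" using assms(2) by simp
  show "\<sigma> t > 0" by (simp add: \<sigma>_def)
  have "\<sigma> t \<le> 2 powr log 2 t" unfolding \<sigma>_def by (intro powr_mono) auto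
  then show "\<sigma> t \<le> t" using t by simp
  have "2 powr log 2 t < 2 powr (1 + of_int \<lfloor>log 2 t\<rfloor>)" by (intro powr_less_mono) linarith+
  then show "t < 2 * \<sigma> t" using t by (simp add: \<sigma>_def powr_add)
  assume u: "t / 2 < u" "u \<le> t"
  have "log 2 (t / 2) < log 2 u" using u assms(2) by (subst log_less_cancel_iff) auto
  then have "log 2 t - 1 < log 2 u" using assms(2) by (simp add: log_divide)
  moreover have "log 2 u \<le> log 2 t" using u assms(2) by (subst log_le_cancel_iff) auto
  ultimately have "\<lfloor>log 2 u\<rfloor> = \<lfloor>log 2 t\<rfloor> \<or> \<lfloor>log 2 u\<rfloor> = \<lfloor>log 2 t\<rfloor> - 1" by linarith
  then show "\<sigma> u = \<sigma> t \<or> \<sigma> u = \<sigma> t / 2" by (auto simp: \<sigma>_def powr_diff)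
qed

text \<open>Pairs far apart relative to their distance from \<open>A\<close> are compared through a
  value of \<open>f\<close>. Closer pairs lie in the same or in adjacent shells; there the gap
  between scales \<open>s\<close> and \<open>2 * s\<close> is of order \<open>s\<close>, while the
  interpolation parameter changes by the difference of the distances to \<open>A\<close> divided by
  \<open>s\<close>, so the scale cancels.\<close>

lemma glue_extensions_at_scales:
  fixes A :: "'a::metric_space set" and f :: "'a \<Rightarrow> 'b::banach"
  assumes ne: "A \<noteq> {}" and lip: "1-lipschitz_on A f" and L: "L \<ge> 0"
    and near: "\<And>s x a. s > 0 \<Longrightarrow> infdist x A < 3 * s \<Longrightarrow> a \<in> A \<Longrightarrow>
                 norm (G s x - f a) \<le> dist x a + 5 * s"
    and lipG: "\<And>s. s > 0 \<Longrightarrow> L-lipschitz_on {x. infdist x A < 3 * s} (G s)"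
  shows "\<exists>F. (\<forall>x\<in>A. F x = f x) \<and> (L + 49)-lipschitz_on UNIV F"
proof -
  define \<delta> where "\<delta> = (\<lambda>x. infdist x A)"
  define \<sigma> :: "'a \<Rightarrow> real" where "\<sigma> = (\<lambda>x. 2 powr of_int \<lfloor>log 2 (\<delta> x)\<rfloor>)"
  \<comment> \<open>On the shell \<open>s \<le> \<delta> x < 2 * s\<close> this runs from
    \<open>G s x\<close> at the inner edge to \<open>G (2 * s) x\<close> at the outer edge, so
    adjacent shells match.\<close>
  define I where "I = (\<lambda>s x. (2 - \<delta> x / s) *\<^sub>R G s x + (\<delta> x / s - 1) *\<^sub>R G (2 * s) x)"
  define F where "F = (\<lambda>x. if x \<in> A then f x else I (\<sigma> x) x)"
  \<comment> \<open>Points of the closure of \<open>A\<close> outside \<open>A\<close> are left out: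
    there \<open>\<delta> x = 0\<close>, no dyadic scale fits, and \<open>F\<close> has a mere
    default value.\<close>
  define X where "X = A \<union> {x. \<delta> x > 0}"
  have \<delta>0: "\<delta> x \<ge> 0" for x by (simp add: \<delta>_def infdist_nonneg)
  have \<delta>A: "\<delta> x = 0" if "x \<in> A" for x using that by (simp add: \<delta>_def)
  have \<delta>D: "\<bar>\<delta> x - \<delta> y\<bar> \<le> dist x y" for x y unfolding \<delta>_def by (rule infdist_triangle_abs)
  have \<sigma>: "\<sigma> x > 0" "\<sigma> x \<le> \<delta> x" "\<delta> x < 2 * \<sigma> x" if "\<delta> x > 0" for x
    unfolding \<sigma>_def by (rule dyadic_scale[OF that])+
  have \<sigma>_half: "\<sigma> y = \<sigma> x \<or> \<sigma> y = \<sigma> x / 2"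
    if "\<delta> x > 0" "\<delta> x / 2 < \<delta> y" "\<delta> y \<le> \<delta> x" for x y
    unfolding \<sigma>_def by (rule dyadic_scale(4)[OF that])
  have FI: "F x = I (\<sigma> x) x" if "\<delta> x > 0" for x using that \<delta>A by (force simp: F_def)
  \<comment> \<open>The room between \<open>2 * s\<close> and \<open>3 * s\<close> provides a point
    of \<open>A\<close> closer than \<open>3 * s\<close>; the two errors then sum to
    \<open>(3 + 5) * s + (3 + 10) * s\<close>.\<close>
  have GG: "norm (G s x - G (2 * s) x) \<le> 21 * s" if s: "s > 0" and x: "\<delta> x \<le> 2 * s" for s x
  proof -
    obtain a where a: "a \<in> A" "dist x a < 3 * s"
      using infdist_lessE[OF ne, of x "3 * s"] x s unfolding \<delta>_def by auto
    have "norm (G s x - f a) \<le> dist x a + 5 * s"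
      using near[OF s _ a(1), of x] x s unfolding \<delta>_def by simp
    moreover have "norm (G (2 * s) x - f a) \<le> dist x a + 5 * (2 * s)"
      using near[of "2 * s" x a] a x s unfolding \<delta>_def by simp
    ultimately show ?thesis
      using a norm_triangle_ineq4[of "G s x - f a" "G (2 * s) x - f a"] by simp
  qed
  have nearF: "norm (F x - f a) \<le> dist x a + 10 * \<delta> x" if x: "x \<in> X" and a: "a \<in> A" for x a
  proof (cases "x \<in> A")
    case True
    then show ?thesis
      using lipschitz_onD[OF lip True a] \<delta>0[of x] by (simp add: F_def dist_norm)
  next
    case False
    then have pos: "\<delta> x > 0" using x by (auto simp: X_def)
    define s where "s = \<sigma> x"
    have s: "s > 0" "s \<le> \<delta> x" "\<delta> x < 2 * s" using \<sigma>[OF pos] by (auto simp: s_def)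
    define t where "t = \<delta> x / s"
    have t: "1 \<le> t" "t \<le> 2" using s by (auto simp: t_def field_simps)
    have "F x - f a = (2 - t) *\<^sub>R (G s x - f a) + (t - 1) *\<^sub>R (G (2 * s) x - f a)"
      unfolding FI[OF pos] I_def s_def[symmetric] t_def[symmetric]
      by (simp add: algebra_simps scaleR_2)
    then have "norm (F x - f a) \<le> norm ((2 - t) *\<^sub>R (G s x - f a)) + norm ((t - 1) *\<^sub>R (G (2 * s) x - f a))"
      by (metis norm_triangle_ineq)
    also have "\<dots> = (2 - t) * norm (G s x - f a) + (t - 1) * norm (G (2 * s) x - f a)"
      using t by simp
    \<comment> \<open>The coarser scale has error \<open>5 * (2 * s)\<close>, and
      \<open>s \<le> \<delta> x\<close>.\<close>
    also have "\<dots> \<le> (2 - t) * (dist x a + 10 * \<delta> x) + (t - 1) * (dist x a + 10 * \<delta> x)"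
    proof (intro add_mono mult_left_mono)
      show "norm (G s x - f a) \<le> dist x a + 10 * \<delta> x"
        using near[of s x a] a s unfolding \<delta>_def by simp
      show "norm (G (2 * s) x - f a) \<le> dist x a + 10 * \<delta> x"
        using near[of "2 * s" x a] a s unfolding \<delta>_def by simp
    qed (use t in auto)
    also have "\<dots> = dist x a + 10 * \<delta> x" by (simp add: algebra_simps)
    finally show ?thesis .
  qed
  have lipF: "norm (F x - F y) \<le> (L + 49) * dist x y"
    if x: "x \<in> X" and y: "y \<in> X" and le: "\<delta> y \<le> \<delta> x" for x y
  proof (cases "\<delta> x \<le> 2 * dist x y")
    case True
    \<comment> \<open>The factor 2 is there because the infimum need not be attained.\<close>
    have "\<exists>a\<in>A. dist x a \<le> 2 * \<delta> x"
    proof (cases "x \<in> A")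
      case True
      then show ?thesis using \<delta>0[of x] by (intro bexI[of _ x]) auto
    next
      case False
      then have "infdist x A < 2 * \<delta> x" using x by (auto simp: X_def \<delta>_def)
      then show ?thesis using infdist_lessE[OF ne] by (metis less_imp_le)
    qed
    then obtain a where a: "a \<in> A" "dist x a \<le> 2 * \<delta> x" by blast
    have "norm (F x - F y) \<le> norm (F x - f a) + norm (F y - f a)"
      using norm_triangle_ineq4[of "F x - f a" "F y - f a"] by simp
    also have "\<dots> \<le> (dist x a + 10 * \<delta> x) + (dist y a + 10 * \<delta> y)"
      using nearF x y a by (intro add_mono) auto
    \<comment> \<open>The distances to \<open>a\<close> contribute
      \<open>4 * \<delta> x + dist x y\<close> and the other terms \<open>20 * \<delta> x\<close>;
      now \<open>\<delta> x \<le> 2 * dist x y\<close>.\<close>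
    also have "\<dots> \<le> 49 * dist x y"
      using a True le dist_triangle3[of y a x] by (simp add: dist_commute)
    also have "\<dots> \<le> (L + 49) * dist x y" using L by (intro mult_right_mono) auto
    finally show ?thesis .
  next
    case False
    then have pos: "\<delta> x > 0" using zero_le_dist[of x y] by linarith
    have half: "\<delta> x / 2 < \<delta> y" using False \<delta>D[of x y] by (simp add: abs_le_iff)
    then have posy: "\<delta> y > 0" using pos by simp
    define s where "s = \<sigma> x"
    have s: "s > 0" "s \<le> \<delta> x" "\<delta> x < 2 * s" using \<sigma>[OF pos] by (auto simp: s_def)
    have sy: "\<sigma> y \<le> \<delta> y" "\<delta> y < 2 * \<sigma> y" using \<sigma>[OF posy] by auto
    have lipxy: "norm (G r x - G r y) \<le> L * dist x y" if "r \<ge> s" for r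
      using lipschitz_onD[OF lipG[of r], of x y] that s le unfolding \<delta>_def by (simp add: dist_norm)
    consider "\<sigma> y = s" | "\<sigma> y = s / 2"
      using \<sigma>_half[OF pos half le] s_def by auto
    then have "norm (F x - F y) \<le> L * dist x y + 21 * \<bar>\<delta> x - \<delta> y\<bar>"
    proof cases
      case 1
      define t u where "t = \<delta> x / s" and "u = \<delta> y / s"
      have t: "1 \<le> t" "t \<le> 2" using s by (auto simp: t_def field_simps)
      \<comment> \<open>The first two terms move the point with the interpolation parameter fixed;
        the third changes the parameter at \<open>y\<close>.\<close>
      have "F x - F y = (2 - t) *\<^sub>R (G s x - G s y) + (t - 1) *\<^sub>R (G (2 * s) x - G (2 * s) y)
          + (u - t) *\<^sub>R (G s y - G (2 * s) y)"
        unfolding FI[OF pos] FI[OF posy] I_def 1 s_def[symmetric] t_def[symmetric] u_def[symmetric]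
        by (simp add: algebra_simps)
      then have "norm (F x - F y) \<le> norm ((2 - t) *\<^sub>R (G s x - G s y))
          + norm ((t - 1) *\<^sub>R (G (2 * s) x - G (2 * s) y)) + norm ((u - t) *\<^sub>R (G s y - G (2 * s) y))"
        by (smt (verit) norm_triangle_ineq)
      also have "\<dots> = (2 - t) * norm (G s x - G s y)
          + (t - 1) * norm (G (2 * s) x - G (2 * s) y) + \<bar>u - t\<bar> * norm (G s y - G (2 * s) y)"
        using t by simp
      also have "\<dots> \<le> (2 - t) * (L * dist x y) + (t - 1) * (L * dist x y) + \<bar>u - t\<bar> * (21 * s)"
        using t s le by (intro add_mono mult_left_mono lipxy GG) auto
      also have "\<bar>u - t\<bar> * (21 * s) = 21 * \<bar>\<delta> x - \<delta> y\<bar>"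
        using s by (simp add: t_def u_def abs_minus_commute flip: diff_divide_distrib)
      finally show ?thesis by (simp add: algebra_simps)
    next
      case 2
      \<comment> \<open>Both interpolations involve the scale \<open>s\<close>, so the path goes
        through \<open>G s x\<close> and \<open>G s y\<close>. The two deviations are proportional
        to \<open>\<delta> x - s\<close> and \<open>s - \<delta> y\<close>, which add up to
        \<open>\<delta> x - \<delta> y\<close>.\<close>
      have ys: "\<delta> y < s" "s / 2 \<le> \<delta> y" using sy 2 by auto
      have "F x - G s x = (1 - \<delta> x / s) *\<^sub>R (G s x - G (2 * s) x)"
        unfolding FI[OF pos] I_def s_def[symmetric]
        by (simp add: algebra_simps scaleR_2)
      then have "norm (F x - G s x) = (\<delta> x / s - 1) * norm (G s x - G (2 * s) x)"
        using s by simp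
      also have "\<dots> \<le> (\<delta> x / s - 1) * (21 * s)"
        using s by (intro mult_left_mono GG) auto
      also have "\<dots> = 21 * (\<delta> x - s)" using s by (simp add: field_simps)
      finally have 1: "norm (F x - G s x) \<le> 21 * (\<delta> x - s)" .
      define h where "h = s / 2"
      have h: "h > 0" "s = 2 * h" using s by (auto simp: h_def)
      have "F y - G (2 * h) y = (2 - \<delta> y / h) *\<^sub>R (G h y - G (2 * h) y)"
        unfolding FI[OF posy] I_def 2 h_def[symmetric]
        by (simp add: algebra_simps scaleR_2)
      then have "norm (F y - G s y) = (2 - \<delta> y / h) * norm (G h y - G (2 * h) y)"
        using h ys by (simp add: divide_le_eq)
      also have "\<dots> \<le> (2 - \<delta> y / h) * (21 * h)"
        using h ys by (intro mult_left_mono GG) (auto simp: field_simps)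
      also have "\<dots> = 21 * (s - \<delta> y)" using h by (simp add: field_simps)
      finally have 3: "norm (F y - G s y) \<le> 21 * (s - \<delta> y)" .
      have "norm (F x - F y) \<le> norm (F x - G s x) + norm (G s x - G s y) + norm (F y - G s y)"
        using norm_triangle_ineq[of "F x - G s x" "G s x - G s y"]
          norm_triangle_ineq4[of "F x - G s y" "F y - G s y"] by simp
      then show ?thesis using 1 3 lipxy[of s] le by simp
    qed
    also have "\<dots> \<le> (L + 49) * dist x y"
      unfolding distrib_right using \<delta>D[of x y] by (intro add_left_mono mult_mono) auto
    finally show ?thesis .
  qed
  have "(L + 49)-lipschitz_on X F"
  proof (rule lipschitz_onI)
    fix x y assume "x \<in> X" "y \<in> X"
    then show "dist (F x) (F y) \<le> (L + 49) * dist x y"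
      using lipF[of x y] lipF[of y x]
      by (cases "\<delta> y \<le> \<delta> x") (auto simp: dist_norm[of "F _"] norm_minus_commute dist_commute)
  qed (use L in simp)
  \<comment> \<open>Completeness of the target enters here, extending \<open>F\<close> from
    \<open>X\<close> to its closure, which is the whole space.\<close>
  then obtain H where H: "(L + 49)-lipschitz_on (closure X) H" "\<forall>x\<in>X. H x = F x"
    using lipschitz_extend_closure by blast
  have "x \<in> closure X" for x
  proof (cases "\<delta> x > 0")
    case True
    then have "x \<in> X" by (simp add: X_def)
    then show ?thesis using closure_subset by auto
  next
    case False
    then have "x \<in> closure A"
      using \<delta>0[of x] ne by (simp add: in_closure_iff_infdist_zero \<delta>_def)
    then show ?thesis using closure_mono[of A X] by (auto simp: X_def)
  qed
  then have "closure X = UNIV" by auto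
  then show ?thesis using H by (intro exI[of _ H]) (auto simp: X_def F_def)
qed

theorem theorem1p4:
  fixes A :: "'a::metric_space set"
    and f :: "'a \<Rightarrow> 'b::banach"
    and M :: real
  assumes "M \<ge> 2"
    and "doubling M A"
    and "1-lipschitz_on A f"
  shows "\<exists>F :: 'a \<Rightarrow> 'b. (\<forall>x\<in>A. F x = f x) \<and> (10 ^ 5 * ln M)-lipschitz_on UNIV F"
proof (cases "A = {}")
  case True
  have "(10 ^ 5 * ln M)-lipschitz_on UNIV (\<lambda>_::'a. 0::'b)"
    using assms(1) by (intro lipschitz_onI) auto
  then show ?thesis using True by auto
next
  case False
  have "\<forall>s>0. \<exists>G. (\<forall>x a. infdist x A < 3 * s \<longrightarrow> a \<in> A \<longrightarrow> norm (G x - f a) \<le> dist x a + 5 * s) \<and>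
      (264 * ln M)-lipschitz_on {x. infdist x A < 3 * s} G"
    using extension_at_scale[OF assms False] by blast
  then obtain G where "\<And>s. s > 0 \<Longrightarrow> (\<forall>x a. infdist x A < 3 * s \<longrightarrow> a \<in> A \<longrightarrow>
        norm (G s x - f a) \<le> dist x a + 5 * s) \<and> (264 * ln M)-lipschitz_on {x. infdist x A < 3 * s} (G s)"
    by metis
  then have "\<exists>F. (\<forall>x\<in>A. F x = f x) \<and> (264 * ln M + 49)-lipschitz_on UNIV F"
    using assms(1) by (intro glue_extensions_at_scales[OF False assms(3)]) auto
  \<comment> \<open>Since \<open>ln M \<ge> 2 / 3\<close>, the summand 49 is at most
    \<open>74 * ln M\<close>.\<close>
  moreover have "264 * ln M + 49 \<le> 10 ^ 5 * ln M"
  proof -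
    have "ln M \<ge> ln 2" using assms(1) by simp
    then show ?thesis using ln2_ge_two_thirds by simp
  qed
  ultimately show ?thesis using lipschitz_on_le by blast
qed

end
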